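(* For every integer $s\ge 6$, one has $$\Pi_{T_s+6}=\{(2,2)\},$$ and $$|M^{(2,2)}_{T_s+6}|=1.$$ Hence $|M_{T_s+6}|=1$ and $m^{\mathrm{sc}}_{T_s+6}=1$.
   Context: For an integer $m\ge 0$, $T_m:=m(m+1)/2$. Compressed form: a partition $\lambda$ is written $\lambda=(L_1^{m_1},\dots,L_r^{m_r})$ with $L_1>\cdots>L_r>0$ its distinct part sizes and $m_i\ge 1$ the multiplicity of $L_i$. Gaps: $g_i=L_i-L_{i+1}$ for $1\le i<r$ and $g_r=L_r$. Set $A(\lambda):=\#\{i:g_i>1\}$ and $B(\lambda):=\#\{i:m_i>1\}$. Partition graph: for $n\ge 1$, $G_n$ is the simple graph whose vertices are the integer partitions of $n$; two distinct partitions are adjacent if one is obtained from the other by an elementary transfer of one unit from one part to another (subtract $1$ from one part and add $1$ to another part), followed by reordering. Here the receiving part may be a zero part (so a new part $1$ may be created), and parts that become $0$ are discarded. $\deg(\lambda)$ is the degree of $\lambda$ in $G_n$, $\Delta_n:=\max_{\lambda\vdash n}\deg(\lambda)$, $M_n:=\{\lambda\vdash n:\deg(\lambda)=\Delta_n\}$, $\Pi_n:=\{(A(\lambda),B(\lambda)):\lambda\in M_n\}$, $M_n^{(a,b)}:=\{\lambda\in M_n:(A(\lambda),B(\lambda))=(a,b)\}$, and $m_n^{\mathrm{sc}}:=|\{\lambda\in M_n:\lambda=\lambda'\}|$, where $\lambda'$ is the conjugate partition. *)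

theory Defs
  imports "HOL-Library.Multiset"
begin

definition triangular :: "nat \<Rightarrow> nat" where
  "triangular m = m * (m + 1) div 2"

definition partitions :: "nat \<Rightarrow> nat multiset set" where
  "partitions n = {p. 0 \<notin># p \<and> sum_mset p = n}"

text \<open>
  In the compressed form \<open>(L\<^sub>1^m\<^sub>1, \<dots>, L\<^sub>r^m\<^sub>r)\<close> with \<open>L\<^sub>1 > \<dots> > L\<^sub>r > 0\<close>,
  the list below is \<open>[L\<^sub>1, \<dots>, L\<^sub>r]\<close>. Indices are shifted to start at \<open>0\<close>.
\<close>

definition part_sizes :: "nat multiset \<Rightarrow> nat list" where
  "part_sizes p = rev (sorted_list_of_set (set_mset p))"

definition part_mult :: "nat multiset \<Rightarrow> nat \<Rightarrow> nat" where
  "part_mult p i = count p (part_sizes p ! i)"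

definition part_gap :: "nat multiset \<Rightarrow> nat \<Rightarrow> nat" where
  "part_gap p i =
     (if Suc i < length (part_sizes p)
      then part_sizes p ! i - part_sizes p ! Suc i
      else part_sizes p ! i)"

definition num_A :: "nat multiset \<Rightarrow> nat" where
  "num_A p = card {i. i < length (part_sizes p) \<and> part_gap p i > 1}"

definition num_B :: "nat multiset \<Rightarrow> nat" where
  "num_B p = card {i. i < length (part_sizes p) \<and> part_mult p i > 1}"

text \<open>
  One unit moves from an occurrence of a part \<open>x\<close> to another occurrence \<open>y\<close>, or to
  the added zero part \<open>y = 0\<close>; in the latter case subtracting \<open>{#y#}\<close> has no
  effect, since \<open>0\<close> is not a part. The filter discards a donor that becomes \<open>0\<close>.
\<close>

definition transfer_to :: "nat multiset \<Rightarrow> nat multiset \<Rightarrow> bool" where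
  "transfer_to p q \<longleftrightarrow>
     (\<exists>x y. x \<in># p \<and> y \<in># add_mset 0 (p - {#x#}) \<and>
        q = filter_mset (\<lambda>z. 0 < z)
               (add_mset (x - 1) (add_mset (y + 1) (p - {#x#} - {#y#}))))"

definition adjacent :: "nat \<Rightarrow> nat multiset \<Rightarrow> nat multiset \<Rightarrow> bool" where
  "adjacent n p q \<longleftrightarrow>
     p \<in> partitions n \<and> q \<in> partitions n \<and> p \<noteq> q \<and>
     (transfer_to p q \<or> transfer_to q p)"

definition deg :: "nat \<Rightarrow> nat multiset \<Rightarrow> nat" where
  "deg n p = card {q. adjacent n p q}"

definition max_deg :: "nat \<Rightarrow> nat" where
  "max_deg n = Max (deg n ` partitions n)"

definition max_deg_partitions :: "nat \<Rightarrow> nat multiset set" where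
  "max_deg_partitions n = {p \<in> partitions n. deg n p = max_deg n}"

definition AB_pairs :: "nat \<Rightarrow> (nat \<times> nat) set" where
  "AB_pairs n = (\<lambda>p. (num_A p, num_B p)) ` max_deg_partitions n"

definition max_deg_partitions_AB :: "nat \<Rightarrow> nat \<times> nat \<Rightarrow> nat multiset set" where
  "max_deg_partitions_AB n ab =
     {p \<in> max_deg_partitions n. (num_A p, num_B p) = ab}"

text \<open>The \<open>j\<close>-th part of the conjugate is the number of parts that are at least \<open>j\<close>.\<close>

definition conjugate :: "nat multiset \<Rightarrow> nat multiset" where
  "conjugate p =
     image_mset (\<lambda>j. size (filter_mset (\<lambda>x. j \<le> x) p))
       (mset_set {j. 1 \<le> j \<and> (\<exists>x \<in># p. j \<le> x)})"

definition num_self_conjugate :: "nat \<Rightarrow> nat" where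
  "num_self_conjugate n = card {p \<in> max_deg_partitions n. p = conjugate p}"

text \<open>Finiteness, so that \<^const>\<open>Max\<close> and \<^const>\<open>card\<close> above have their intended meaning.\<close>

lemma finite_partitions: "finite (partitions n)"
proof -
  have "partitions n \<subseteq> mset ` {xs. set xs \<subseteq> {..n} \<and> length xs \<le> n}"
  proof
    fix p assume l: "p \<in> partitions n"
    obtain xs where xs: "p = mset xs" by (metis ex_mset)
    have s: "sum_list xs = n" and p: "\<forall>x \<in> set xs. 0 < x"
      using l by (auto simp: partitions_def xs sum_mset_sum_list intro!: Nat.gr0I)
    have "length xs \<le> sum_list xs" using p by (induction xs) force+
    moreover have "set xs \<subseteq> {..n}" using member_le_sum_list[of _ xs] s by auto
    ultimately show "p \<in> mset ` {xs. set xs \<subseteq> {..n} \<and> length xs \<le> n}"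
      using xs s by auto
  qed
  then show ?thesis
    using finite_lists_length_le[of "{..n}" n] finite_subset by blast
qed

lemma partitions_nonempty: "partitions n \<noteq> {}"
proof -
  have "replicate_mset n 1 \<in> partitions n" by (auto simp: partitions_def sum_mset_replicate_mset)
  then show ?thesis by blast
qed

end

theory Submission
  imports Defs
begin

text \<open>
  A partition with \<open>r\<close> distinct part sizes has degree \<open>r * (r - 1) + A + B\<close>: of the
  \<open>r * (r + 1)\<close> pairs of donor and receiver sizes, \<open>r - A\<close> give back the same partition
  and \<open>r - B\<close> would need a second copy of a part, and the others give distinct neighbours.
  As \<open>A, B \<le> r\<close>, fewer than \<open>s\<close> sizes give degree at most \<open>s * (s - 1)\<close>.
  With \<open>s\<close> sizes, the sum exceeds \<open>T\<^sub>s\<close> by a contribution from the gaps and one from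
  the repeated copies. A gap costs at least the number of sizes above it, and these numbers
  are distinct; a repeated part costs at least its size. Hence \<open>T\<^sub>A + T\<^sub>B \<le> 6\<close>, so
  \<open>A + B \<ge> 4\<close> forces \<open>A = B = 2\<close> with every cost minimal, which determines the partition
  \<open>(s + 2, s, s - 2, s - 3, \<dots>, 3, 2\<^sup>2, 1\<^sup>2)\<close>.
\<close>

section \<open>Unit transfers as pairs of donor and receiver\<close>

abbreviation parts_ge :: "nat \<Rightarrow> nat multiset \<Rightarrow> nat" where
  "parts_ge k p \<equiv> size (filter_mset (\<lambda>x. k \<le> x) p)"

definition move_unit :: "nat multiset \<Rightarrow> nat \<times> nat \<Rightarrow> nat multiset" where
  "move_unit p = (\<lambda>(x, y). filter_mset (\<lambda>z. 0 < z)
     (add_mset (x - 1) (add_mset (y + 1) (p - {#x#} - {#y#}))))"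

text \<open>Pairs of sizes rather than of occurrences: equal parts lead to the same neighbour, so
  each pair is to be counted once.\<close>

definition moves :: "nat multiset \<Rightarrow> (nat \<times> nat) set" where
  "moves p = {(x, y). x \<in># p \<and> y \<in># add_mset 0 (p - {#x#})}"

text \<open>The added 0 serves as a lower end, so that the last gap, which is the smallest size
  itself, is treated like the others.\<close>

definition gap_parts :: "nat multiset \<Rightarrow> nat set" where
  "gap_parts p = {x \<in> set_mset p. x - 1 \<notin> insert 0 (set_mset p)}"

definition repeated_parts :: "nat multiset \<Rightarrow> nat set" where
  "repeated_parts p = {x \<in> set_mset p. 1 < count p x}"

lemma transfer_to_iff: "transfer_to p q \<longleftrightarrow> (\<exists>m \<in> moves p. q = move_unit p m)"
  by (auto simp: transfer_to_def moves_def move_unit_def)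

text \<open>With \<open>R\<close> the untouched parts, the zero receiver and a genuine receiver lead
  to the same formula for the result; only the shape of \<open>p\<close> differs.\<close>

lemma move_cases:
  assumes "(x, y) \<in> moves p" "0 \<notin># p"
  obtains R where "0 < x" "0 \<notin># R" "y = 0" "p = add_mset x R"
      "move_unit p (x, y) = filter_mset (\<lambda>z. 0 < z) (add_mset (x - 1) (add_mset (y + 1) R))"
    | R where "0 < x" "0 \<notin># R" "0 < y" "p = add_mset x (add_mset y R)"
      "move_unit p (x, y) = filter_mset (\<lambda>z. 0 < z) (add_mset (x - 1) (add_mset (y + 1) R))"
proof -
  have x: "x \<in># p" and y: "y \<in># add_mset 0 (p - {#x#})" using assms by (auto simp: moves_def)
  obtain Q where Q: "p = add_mset x Q" using x by (meson mset_add)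
  have x0: "0 < x" "0 \<notin># Q" using assms Q by (auto intro!: Nat.gr0I)
  show thesis
  proof (cases "y = 0")
    case True
    have "Q - {#0#} = Q" using x0 by (simp add: diff_single_trivial)
    then show thesis using that(1)[of Q] x0 True Q by (simp add: move_unit_def)
  next
    case False
    then have "y \<in># Q" using y Q by simp
    then obtain R where "Q = add_mset y R" by (meson mset_add)
    then show thesis using that(2)[of R] x0 False Q by (simp add: move_unit_def)
  qed
qed

text \<open>
  In terms of the conjugate partition, whose parts are the numbers \<open>parts_ge k p\<close>, a
  transfer moves one cell from row \<open>x\<close> to row \<open>y + 1\<close>. This is why distinct
  nontrivial transfers give distinct neighbours.
\<close>

lemma parts_ge_move_unit:
  assumes "m \<in> moves p" "0 \<notin># p" "0 < k"
  shows "parts_ge k (move_unit p m) + of_bool (k = fst m) = parts_ge k p + of_bool (k = snd m + 1)"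
proof -
  obtain x y where m: "m = (x, y)" by force
  \<comment> \<open>For \<open>k > 0\<close>, zero parts are never counted, so discarding them is
    invisible here.\<close>
  have f: "filter_mset (\<lambda>z. k \<le> z) (filter_mset (\<lambda>z. 0 < z) M) = filter_mset (\<lambda>z. k \<le> z) M" for M
    using assms(3) by (auto simp: filter_filter_mset intro!: filter_mset_cong)
  from assms(1)[unfolded m] assms(2) show ?thesis
  proof (cases rule: move_cases)
    case (1 R)
    then show ?thesis using assms(3) unfolding m 1(5) f by auto
  next
    case (2 R)
    then show ?thesis using assms(3) unfolding m 2(5) f by auto
  qed
qed

lemma inj_on_move_unit:
  assumes "0 \<notin># p"
  shows "inj_on (move_unit p) {m \<in> moves p. fst m \<noteq> snd m + 1}"
proof (rule inj_onI)
  fix m m' assume m: "m \<in> {m \<in> moves p. fst m \<noteq> snd m + 1}" "m' \<in> {m \<in> moves p. fst m \<noteq> snd m + 1}"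
    and eq: "move_unit p m = move_unit p m'"
  have "0 < fst m" using m assms by (auto simp: moves_def intro!: Nat.gr0I)
  moreover have "of_bool (k = snd m' + 1) + of_bool (k = fst m) = (of_bool (k = snd m + 1) + of_bool (k = fst m') :: nat)"
    if "0 < k" for k
    using parts_ge_move_unit[of m p k] parts_ge_move_unit[of m' p k] m assms eq that by simp
  \<comment> \<open>The donor row is the only row that loses a cell and the receiver row the only
    one that gains one; as these rows differ, evaluating at both recovers the pair.\<close>
  from this[of "fst m"] this[of "snd m + 1"] calculation m show "m = m'"
    by (auto simp: prod_eq_iff of_bool_def split: if_splits)
qed

text \<open>When \<open>x = y + 1\<close> the two parts exchange their sizes. Otherwise row
  \<open>y + 1\<close> of the conjugate gains a cell.\<close>

lemma move_unit_eq_iff: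
  assumes "m \<in> moves p" "0 \<notin># p"
  shows "move_unit p m = p \<longleftrightarrow> fst m = snd m + 1"
proof
  assume "move_unit p m = p"
  then show "fst m = snd m + 1"
    using parts_ge_move_unit[OF assms, of "snd m + 1"] by (cases "fst m = snd m + 1") auto
next
  assume eq: "fst m = snd m + 1"
  obtain x y where m: "m = (x, y)" by force
  have f: "0 \<notin># R \<Longrightarrow> filter_mset (\<lambda>z. 0 < z) R = R" for R :: "nat multiset"
    by (auto simp: filter_mset_eq_conv intro!: Nat.gr0I)
  from assms(1)[unfolded m] assms(2) show "move_unit p m = p"
    by (cases rule: move_cases) (use eq m f in auto)
qed

lemma move_unit_in_partitions:
  assumes "m \<in> moves p" "p \<in> partitions n"
  shows "move_unit p m \<in> partitions n"
proof -
  obtain x y where m: "m = (x, y)" by force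
  have p: "0 \<notin># p" "sum_mset p = n" using assms by (auto simp: partitions_def)
  have f: "sum_mset (filter_mset (\<lambda>z. 0 < z) R) = sum_mset R" for R :: "nat multiset"
    by (induction R) auto
  have "sum_mset (move_unit p m) = n"
    using assms(1)[unfolded m] p(1)
    by (cases rule: move_cases) (use p(2) in \<open>simp_all only: m f, simp_all\<close>)
  moreover have "0 \<notin># move_unit p m" by (simp add: move_unit_def m del: filter_mset_add_mset filter_diff_mset)
  ultimately show ?thesis by (simp add: partitions_def)
qed

text \<open>The inverse move has donor \<open>y + 1\<close> and receiver \<open>x - 1\<close>, which
  is the added zero part when \<open>x = 1\<close>. Hence one direction in \<open>adjacent\<close>
  suffices to list the neighbours.\<close>

lemma transfer_to_sym:
  assumes "transfer_to p q" "0 \<notin># p"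
  shows "transfer_to q p"
proof -
  obtain x y where m: "(x, y) \<in> moves p" "q = move_unit p (x, y)"
    using assms(1) by (auto simp: transfer_to_iff)
  have f: "0 \<notin># R \<Longrightarrow> filter_mset (\<lambda>z. 0 < z) R = R" for R :: "nat multiset"
    by (auto simp: filter_mset_eq_conv intro!: Nat.gr0I)
  have "(y + 1, x - 1) \<in> moves q \<and> p = move_unit q (y + 1, x - 1)"
    using m(1) assms(2)
  proof (cases rule: move_cases)
    case (1 R)
    then show ?thesis
      by (cases "x = 1") (auto simp: m(2) moves_def move_unit_def f diff_single_trivial)
  next
    case (2 R)
    then show ?thesis
      by (cases "x = 1") (auto simp: m(2) moves_def move_unit_def f diff_single_trivial)
  qed
  then show ?thesis by (auto simp: transfer_to_iff)
qed

lemma neighbours_eq: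
  assumes "p \<in> partitions n"
  shows "{q. adjacent n p q} = move_unit p ` {m \<in> moves p. fst m \<noteq> snd m + 1}"
proof -
  have p: "0 \<notin># p" using assms by (simp add: partitions_def)
  have "adjacent n p q \<longleftrightarrow> q \<noteq> p \<and> transfer_to p q" for q
    using assms transfer_to_sym[OF _ p] move_unit_in_partitions[OF _ assms]
    by (auto simp: adjacent_def transfer_to_iff) 
      (metis mem_Collect_eq partitions_def transfer_to_iff transfer_to_sym)+
  then show ?thesis using move_unit_eq_iff[OF _ p] by (auto simp: transfer_to_iff)
qed

section \<open>The degree formula\<close>

text \<open>The pairs in \<open>S \<times> (S \<union> {0})\<close> that are not counted are
  subtracted. The term \<open>2 * r\<close> stands on the left to avoid truncated
  subtraction.\<close>

lemma card_moves:
  assumes "0 \<notin># p"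
  defines "r \<equiv> card (set_mset p)"
  shows "card {m \<in> moves p. fst m \<noteq> snd m + 1} + 2 * r
    = r * (r + 1) + card (gap_parts p) + card (repeated_parts p)"
proof -
  let ?S = "set_mset p" and ?P = "{m \<in> moves p. fst m \<noteq> snd m + 1}"
  let ?X = "?S - gap_parts p" and ?Y = "?S - repeated_parts p"
  let ?U = "(\<lambda>x. (x, x - 1)) ` ?X" and ?V = "(\<lambda>x. (x, x)) ` ?Y"
  have pos: "0 < x" if "x \<in># p" for x using assms(1) that by (auto intro!: Nat.gr0I)
  have mem: "y \<in># p - {#x#} \<longleftrightarrow> y \<in># p \<and> (y = x \<longrightarrow> 1 < count p x)" for x y
    by (auto simp: in_diff_count simp flip: count_greater_zero_iff)
  \<comment> \<open>\<open>?U\<close> holds the moves that change nothing, \<open>?V\<close> the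
    pairs that would need a second copy of \<open>x\<close>.\<close>
  have un: "?S \<times> insert 0 ?S = ?P \<union> (?U \<union> ?V)"
    using pos by (fastforce simp: moves_def mem gap_parts_def repeated_parts_def image_iff)
  have fin: "finite ?P"
    by (rule finite_subset[of _ "?S \<times> insert 0 ?S"]) (simp add: un, simp)
  have dis: "?P \<inter> (?U \<union> ?V) = {}" "?U \<inter> ?V = {}"
  proof -
    have "y < x" if "(x, y) \<in> ?U" for x y using that pos[of x] by auto
    then show "?U \<inter> ?V = {}" by blast
    have "(x, y) \<notin> ?P" if "(x, y) \<in> ?U \<union> ?V" for x y
    proof -
      have "x = y + 1 \<or> (x = y \<and> x \<noteq> 0 \<and> \<not> 1 < count p x)"
        using that pos[of x] by (auto simp: repeated_parts_def)
      then show ?thesis by (auto simp: moves_def mem)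
    qed
    then show "?P \<inter> (?U \<union> ?V) = {}" by blast
  qed
  have "card (?S \<times> insert 0 ?S) = card ?P + (card ?U + card ?V)"
    unfolding un using fin dis by (simp add: card_Un_disjoint)
  moreover have "card ?U = r - card (gap_parts p)" "card ?V = r - card (repeated_parts p)"
    unfolding r_def
    by (subst card_image card_Diff_subset; auto simp: inj_on_def gap_parts_def repeated_parts_def)+
  moreover have "card (gap_parts p) \<le> r" "card (repeated_parts p) \<le> r"
    unfolding r_def by (auto simp: gap_parts_def repeated_parts_def intro!: card_mono)
  moreover have "card (?S \<times> insert 0 ?S) = r * (r + 1)"
    using assms(1) by (simp add: card_cartesian_product r_def)
  ultimately show ?thesis by linarith
qed

lemma deg_eq:
  assumes "p \<in> partitions n"
  defines "r \<equiv> card (set_mset p)"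
  shows "deg n p + 2 * r = r * (r + 1) + card (gap_parts p) + card (repeated_parts p)"
proof -
  have p: "0 \<notin># p" using assms by (simp add: partitions_def)
  show ?thesis
    unfolding deg_def neighbours_eq[OF assms(1)] card_image[OF inj_on_move_unit[OF p]]
    using card_moves[OF p] by (simp add: r_def)
qed

section \<open>Index counts \<open>num_A\<close> and \<open>num_B\<close> as cardinalities of sets
  of sizes\<close>

lemma card_nth_filter:
  assumes "distinct xs"
  shows "card {i. i < length xs \<and> P (xs ! i)} = card {x \<in> set xs. P x}"
  by (rule bij_betw_same_card[of "(!) xs"])
     (use assms in \<open>auto simp: bij_betw_def inj_on_def nth_eq_iff_index_eq in_set_conv_nth image_iff\<close>)

lemma part_sizes_props:
  "set (part_sizes p) = set_mset p" "distinct (part_sizes p)"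
  "\<And>i j. i < j \<Longrightarrow> j < length (part_sizes p) \<Longrightarrow> part_sizes p ! j < part_sizes p ! i"
proof -
  show "set (part_sizes p) = set_mset p" "distinct (part_sizes p)" by (auto simp: part_sizes_def)
  fix i j assume "i < j" "j < length (part_sizes p)"
  moreover have "sorted_wrt (\<lambda>a b. b < a) (part_sizes p)"
    unfolding part_sizes_def sorted_wrt_rev using strict_sorted_list_of_set by blast
  ultimately show "part_sizes p ! j < part_sizes p ! i" using sorted_wrt_nth_less by blast
qed

lemma num_B_eq: "num_B p = card (repeated_parts p)"
  using card_nth_filter[OF part_sizes_props(2), of p "\<lambda>x. 1 < count p x"]
  by (simp add: num_B_def part_mult_def repeated_parts_def part_sizes_props(1))

lemma num_A_eq:
  assumes "0 \<notin># p"
  shows "num_A p = card (gap_parts p)"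
proof -
  let ?xs = "part_sizes p"
  have pos: "0 < ?xs ! i" if "i < length ?xs" for i
    using that assms part_sizes_props(1)[of p] nth_mem[OF that] by (metis gr0I)
  have "1 < part_gap p i \<longleftrightarrow> ?xs ! i - 1 \<notin> insert 0 (set_mset p)" if i: "i < length ?xs" for i
  proof -
    \<comment> \<open>The sizes strictly decrease, and no integer lies strictly between
      \<open>?xs ! i - 1\<close> and \<open>?xs ! i\<close>, so the value \<open>?xs ! i - 1\<close>
      can only occur at the next index.\<close>
    have "?xs ! i - 1 \<in> set_mset p \<longleftrightarrow> Suc i < length ?xs \<and> ?xs ! i = ?xs ! Suc i + 1"
    proof
      assume "?xs ! i - 1 \<in> set_mset p"
      then obtain j where j: "j < length ?xs" "?xs ! j = ?xs ! i - 1"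
        by (metis in_set_conv_nth part_sizes_props(1))
      have "i < j"
        using j part_sizes_props(3)[of j i p] pos[OF i] i by (cases i j rule: linorder_cases) auto
      then show "Suc i < length ?xs \<and> ?xs ! i = ?xs ! Suc i + 1"
        using j part_sizes_props(3)[of i "Suc i" p] part_sizes_props(3)[of "Suc i" j p] pos[OF i]
        by (cases "j = Suc i") auto
    next
      assume "Suc i < length ?xs \<and> ?xs ! i = ?xs ! Suc i + 1"
      then show "?xs ! i - 1 \<in> set_mset p" using nth_mem[of "Suc i" ?xs] part_sizes_props(1)[of p] by simp
    qed
    then show ?thesis
      using part_sizes_props(3)[of i "Suc i" p] pos[OF i] pos[of "Suc i"]
      by (auto simp: part_gap_def)
  qed
  then have "num_A p = card {i. i < length ?xs \<and> ?xs ! i - 1 \<notin> insert 0 (set_mset p)}"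
    unfolding num_A_def by (metis (lifting))
  also have "\<dots> = card (gap_parts p)"
    using card_nth_filter[OF part_sizes_props(2), of p "\<lambda>x. x - 1 \<notin> insert 0 (set_mset p)"]
    by (simp add: gap_parts_def part_sizes_props(1))
  finally show ?thesis .
qed

section \<open>Triangular numbers and sums of distinct sizes\<close>

lemma two_triangular: "2 * triangular m = m * (m + 1)"
  by (simp add: triangular_def)

lemma triangular_Suc: "triangular (Suc m) = triangular m + Suc m"
  using two_triangular[of m] two_triangular[of "Suc m"] by (simp add: algebra_simps)

lemma triangular_mono: "m \<le> n \<Longrightarrow> triangular m \<le> triangular n"
  by (induction rule: dec_induct) (auto simp: triangular_Suc)

text \<open>The summands are the ranks of the elements, that is, 1 up to
  \<open>card S\<close>.\<close>

lemma sum_rank_eq_triangular: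
  fixes S :: "nat set"
  assumes "finite S"
  shows "(\<Sum>x\<in>S. card {y \<in> S. y \<le> x}) = triangular (card S)"
  using assms
proof (induction S rule: finite_linorder_max_induct)
  case empty
  then show ?case by (simp add: triangular_def)
next
  case (insert b A)
  have "b \<notin> A" using insert by auto
  have "{y \<in> insert b A. y \<le> x} = {y \<in> A. y \<le> x}" if "x \<in> A" for x using insert that by auto
  moreover have "{y \<in> insert b A. y \<le> b} = insert b A" using insert by auto
  ultimately show ?case using insert \<open>b \<notin> A\<close> by (simp add: triangular_Suc)
qed

text \<open>Each element is its rank plus the number of missing positive values below it. Exchanging
  the summations charges every hole with the number of elements above it.\<close>

lemma sum_eq_triangular_plus_holes:
  fixes S :: "nat set"
  assumes "finite S" "0 \<notin> S" "\<forall>x \<in> S. x \<le> N"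
  shows "\<Sum>S = triangular (card S) + (\<Sum>h \<in> {1..N} - S. card {x \<in> S. h < x})"
proof -
  have "x = card {y \<in> S. y \<le> x} + (\<Sum>h \<in> {1..N} - S. of_bool (h < x))" if "x \<in> S" for x
  proof -
    have "x \<le> N" using assms that by blast
    have "h \<in> {1..x} \<longleftrightarrow> h \<in> {y \<in> S. y \<le> x} \<union> {h \<in> {1..N} - S. h < x}" for h
      using assms(2) that \<open>x \<le> N\<close> by (cases "h = 0"; cases "h = x"; auto)
    then have "{1..x} = {y \<in> S. y \<le> x} \<union> {h \<in> {1..N} - S. h < x}" by blast
    then have "card {1..x} = card {y \<in> S. y \<le> x} + card {h \<in> {1..N} - S. h < x}"
      using assms by (subst card_Un_disjoint[symmetric]) auto
    then show ?thesis by (simp add: of_bool_def sum.If_cases Int_def conj_ac)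
  qed
  then have "\<Sum>S = (\<Sum>x\<in>S. card {y \<in> S. y \<le> x}) + (\<Sum>x\<in>S. \<Sum>h \<in> {1..N} - S. of_bool (h < x))"
    by (subst sum.distrib[symmetric]) (rule sum.cong, auto)
  also have "(\<Sum>x\<in>S. \<Sum>h \<in> {1..N} - S. of_bool (h < x)) = (\<Sum>h \<in> {1..N} - S. card {x \<in> S. h < x})"
    using assms(1) by (subst sum.swap) (auto simp: of_bool_def sum.If_cases Int_def)
  finally show ?thesis by (simp add: sum_rank_eq_triangular[OF assms(1)])
qed

lemma triangular_card_le_sum:
  fixes S :: "nat set"
  assumes "finite S" "0 \<notin> S"
  shows "triangular (card S) \<le> \<Sum>S"
  using sum_eq_triangular_plus_holes[OF assms, of "Max S"] assms by simp

lemma sum_mset_eq_sum_set_plus: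
  fixes p :: "nat multiset"
  shows "sum_mset p = \<Sum>(set_mset p) + sum_mset (p - mset_set (set_mset p))"
proof -
  have "p = mset_set (set_mset p) + (p - mset_set (set_mset p))"
    using mset_set_set_mset_msubset subset_mset.add_diff_inverse by metis
  then have "sum_mset p = sum_mset (mset_set (set_mset p)) + sum_mset (p - mset_set (set_mset p))"
    by (metis sum_mset.union)
  then show ?thesis by (simp add: sum_unfold_sum_mset)
qed

text \<open>Removing one copy of each size leaves the excess copies, whose support is the set of
  repeated sizes.\<close>

lemma set_mset_excess: "set_mset (p - mset_set (set_mset p)) = repeated_parts p"
proof -
  have "count (mset_set (set_mset p)) x = of_bool (x \<in># p)" for x
    by (simp add: count_mset_set')
  then show ?thesis by (auto simp: repeated_parts_def in_diff_count not_in_iff of_bool_def split: if_splits)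
qed

lemma nat_set_card_2_sum_3:
  fixes S :: "nat set"
  assumes "card S = 2" "0 \<notin> S" "\<Sum>S = 3"
  shows "S = {1, 2}"
proof -
  obtain a b where ab: "S = {a, b}" "a \<noteq> b" using assms(1) by (auto simp: card_2_iff)
  then have "a + b = 3" "0 < a" "0 < b" using assms by auto
  then have "a = 1 \<and> b = 2 \<or> a = 2 \<and> b = 1" using ab(2) by linarith
  then show ?thesis using ab by auto
qed

section \<open>Uniqueness of the partition of large degree\<close>

text \<open>For \<open>s \<ge> 6\<close> the holes below \<open>s + 2\<close> are
  \<open>s + 1\<close> and \<open>s - 1\<close>, with one and two sizes above them: the cheapest two
  gaps.\<close>

definition extremal_sizes :: "nat \<Rightarrow> nat set" where
  "extremal_sizes s = {1..s - 2} \<union> {s, s + 2}"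

definition extremal_partition :: "nat \<Rightarrow> nat multiset" where
  "extremal_partition s = mset_set (extremal_sizes s) + {#1, 2#}"

text \<open>If \<open>h < h'\<close>, then \<open>h + 1\<close> is counted above \<open>h\<close>
  but not above \<open>h'\<close>. This makes the costs of different gaps distinct.\<close>

lemma card_greater_eq_imp_le:
  fixes S :: "nat set"
  assumes "finite S" "h + 1 \<in> S" "card {x \<in> S. h < x} = card {x \<in> S. h' < x}"
  shows "h' \<le> h"
proof (rule ccontr)
  assume "\<not> h' \<le> h"
  then have "{x \<in> S. h' < x} \<subseteq> {x \<in> S. h < x}" "h + 1 \<in> {x \<in> S. h < x} - {x \<in> S. h' < x}"
    using assms(2) by auto
  then have "{x \<in> S. h' < x} \<subset> {x \<in> S. h < x}" by blast
  then have "card {x \<in> S. h' < x} < card {x \<in> S. h < x}"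
    using assms(1) by (intro psubset_card_mono) auto
  then show False using assms(3) by simp
qed

text \<open>\<open>G\<close> contains one hole per gap, the one just below a size, and
  \<open>w\<close> is the cost of a hole. The last sum collects the holes further down in gaps of
  length over 2 and the values above all sizes, which cost 0.\<close>

lemma sum_eq_triangular_plus_gaps:
  fixes S :: "nat set"
  assumes "finite S" "0 \<notin> S" "\<forall>x \<in> S. x \<le> N"
  defines "G \<equiv> {h \<in> {1..N} - S. h + 1 \<in> S}" and "w \<equiv> \<lambda>h. card {x \<in> S. h < x}"
  shows "inj_on w G" "0 \<notin> w ` G"
    "\<Sum>S = triangular (card S) + \<Sum>(w ` G) + (\<Sum>h \<in> {1..N} - S - G. w h)"
proof -
  show inj: "inj_on w G"
  proof (rule inj_onI)
    fix h h' assume "h \<in> G" "h' \<in> G" "w h = w h'"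
    then show "h = h'"
      using card_greater_eq_imp_le[OF assms(1), of h h'] card_greater_eq_imp_le[OF assms(1), of h' h]
      by (simp add: w_def G_def)
  qed
  show "0 \<notin> w ` G" using assms(1) by (auto simp: w_def G_def)
  have "(\<Sum>h \<in> {1..N} - S. w h) = (\<Sum>h \<in> {1..N} - S - G. w h) + (\<Sum>h \<in> G. w h)"
    by (rule sum.subset_diff) (auto simp: G_def)
  then show "\<Sum>S = triangular (card S) + \<Sum>(w ` G) + (\<Sum>h \<in> {1..N} - S - G. w h)"
    using sum_eq_triangular_plus_holes[OF assms(1-3)] inj by (simp add: sum.reindex w_def)
qed

lemma card_gap_parts:
  assumes "0 \<notin># p" "\<forall>x \<in># p. x \<le> N"
  shows "card (gap_parts p) = card {h \<in> {1..N} - set_mset p. h + 1 \<in># p}"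
proof -
  let ?H = "{h \<in> {1..N} - set_mset p. h + 1 \<in># p}"
  have "gap_parts p = Suc ` ?H"
  proof
    show "Suc ` ?H \<subseteq> gap_parts p" by (auto simp: gap_parts_def)
    show "gap_parts p \<subseteq> Suc ` ?H"
    proof
      fix x assume x: "x \<in> gap_parts p"
      then have "x \<le> N" "x = Suc (x - 1)" using assms by (auto simp: gap_parts_def)
      then show "x \<in> Suc ` ?H" using x by (intro image_eqI[of _ _ "x - 1"]) (auto simp: gap_parts_def)
    qed
  qed
  then show ?thesis by (simp add: card_image)
qed

text \<open>Only \<open>a\<close> and \<open>b\<close> are missing below the maximum
  \<open>N\<close>. One size above \<open>a\<close> means \<open>a = N - 1\<close>; two above
  \<open>b\<close>, with \<open>a\<close> skipped, mean \<open>b = N - 3\<close>. Counting then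
  gives \<open>N = s + 2\<close>.\<close>

lemma sizes_unique:
  fixes S :: "nat set"
  assumes "finite S" "0 \<notin> S" "card S = s" "3 \<le> s"
    and N: "N \<in> S" "\<forall>x \<in> S. x \<le> N"
    and no_other: "\<And>h. 1 \<le> h \<Longrightarrow> h < N \<Longrightarrow> h \<notin> S \<Longrightarrow> h = a \<or> h = b"
    and a: "1 \<le> a" "a \<notin> S" "card {x \<in> S. a < x} = 1"
    and b: "1 \<le> b" "b \<notin> S" "card {x \<in> S. b < x} = 2"
  shows "S = extremal_sizes s"
proof -
  have aN: "a < N" "b < N"
  proof -
    { fix c assume "card {x \<in> S. c < x} \<noteq> 0"
      then have "{x \<in> S. c < x} \<noteq> {}" by (metis card.empty)
      then have "c < N" using N by force }
    then show "a < N" "b < N" using a b by auto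
  qed
  have "b < a"
  proof (rule ccontr)
    assume "\<not> b < a"
    then have "card {x \<in> S. b < x} \<le> card {x \<in> S. a < x}" using assms(1) by (intro card_mono) auto
    then show False using a b by simp
  qed
  have S: "S = {1..N} - {a, b}"
  proof
    show "S \<subseteq> {1..N} - {a, b}"
    proof
      fix x assume "x \<in> S"
      then have "x \<noteq> 0" "x \<le> N" "x \<noteq> a" "x \<noteq> b" using assms(2) N(2) a(2) b(2) by metis+
      then show "x \<in> {1..N} - {a, b}" by simp
    qed
    show "{1..N} - {a, b} \<subseteq> S"
    proof
      fix x assume "x \<in> {1..N} - {a, b}"
      then show "x \<in> S" using no_other[of x] N(1) by (cases "x = N") auto
    qed
  qed
  have "{x \<in> S. a < x} = {a<..N}" unfolding S using \<open>b < a\<close> by auto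
  then have Na: "N = a + 1" using a aN by simp
  have "{x \<in> S. b < x} = {b<..N} - {a}" unfolding S using \<open>b < a\<close> \<open>1 \<le> b\<close> by auto
  then have "N - b - 1 = 2" using b \<open>b < a\<close> aN by simp
  then have Nb: "N = b + 3" using aN by simp
  have "card S = N - 2" unfolding S using a b aN \<open>b < a\<close> by (subst card_Diff_subset) auto
  then have "N = s + 2" using assms(3,4) by simp
  then show ?thesis
    unfolding S extremal_sizes_def using Na Nb \<open>3 \<le> s\<close> by auto
qed

text \<open>\<open>triangular 4 = 10\<close> exceeds the budget, so only values up to 3 remain to be
  checked.\<close>

lemma two_two_of_triangular_bound:
  assumes "triangular a + triangular b \<le> 6" "4 \<le> a + b"
  shows "a = 2 \<and> b = 2"
proof -
  have T: "triangular 0 = 0" "triangular 1 = 1" "triangular 2 = 3" "triangular 3 = 6" "triangular 4 = 10"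
    by (simp_all add: triangular_def)
  have "\<not> 4 \<le> a" "\<not> 4 \<le> b"
    using triangular_mono[of 4 a] triangular_mono[of 4 b] T assms(1) by auto
  then have "a \<in> {0, 1, 2, 3}" "b \<in> {0, 1, 2, 3}" by auto
  then show ?thesis using assms T by auto
qed

text \<open>The threshold is the degree of \<open>extremal_partition s\<close>, so this yields both
  its maximality and its uniqueness.\<close>

lemma large_deg_imp_extremal:
  assumes "6 \<le> s" "p \<in> partitions (triangular s + 6)" "s * (s - 1) + 4 \<le> deg (triangular s + 6) p"
  shows "p = extremal_partition s \<and> card (gap_parts p) = 2 \<and> card (repeated_parts p) = 2"
proof -
  let ?S = "set_mset p"
  define r where "r = card ?S"
  define N where "N = Max ?S"
  define G where "G = {h \<in> {1..N} - ?S. h + 1 \<in> ?S}"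
  define w where "w = (\<lambda>h. card {x \<in> ?S. h < x})"
  define E where "E = p - mset_set ?S"
  have p: "0 \<notin># p" "sum_mset p = triangular s + 6" using assms(2) by (auto simp: partitions_def)
  then have ne: "p \<noteq> {#}" by auto
  have N: "N \<in> ?S" "\<forall>x \<in> ?S. x \<le> N" using ne by (auto simp: N_def)
  note gaps = sum_eq_triangular_plus_gaps[OF finite_set_mset p(1) N(2), folded G_def w_def r_def]
  have cG: "card (gap_parts p) = card G" using card_gap_parts[OF p(1) N(2)] by (simp add: G_def)
  have setE: "set_mset E = repeated_parts p" by (simp add: E_def set_mset_excess)
  have E0: "0 \<notin> repeated_parts p" using p by (auto simp: repeated_parts_def)
  have "sum_mset p = \<Sum>?S + sum_mset E" by (simp add: E_def sum_mset_eq_sum_set_plus[of p])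
  \<comment> \<open>A second splitting takes one excess copy of each repeated size, leaving third
    and further copies.\<close>
  moreover have "sum_mset E = \<Sum>(repeated_parts p) + sum_mset (E - mset_set (repeated_parts p))"
    using sum_mset_eq_sum_set_plus[of E] by (simp add: setE)
  ultimately have total: "triangular s + 6 = triangular r + \<Sum>(w ` G) + (\<Sum>h \<in> {1..N} - ?S - G. w h)
      + \<Sum>(repeated_parts p) + sum_mset (E - mset_set (repeated_parts p))"
    using gaps(3) p(2) by simp
  have finG: "finite G" by (simp add: G_def)
  have cwG: "card (w ` G) = card G" using gaps(1) by (rule card_image)
  have TG: "triangular (card G) \<le> \<Sum>(w ` G)"
    using triangular_card_le_sum[of "w ` G"] finG gaps(2) cwG by simp
  have finR: "finite (repeated_parts p)" by (simp add: repeated_parts_def)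
  have TR: "triangular (card (repeated_parts p)) \<le> \<Sum>(repeated_parts p)"
    using triangular_card_le_sum[OF finR E0] .
  \<comment> \<open>Here \<open>s \<ge> 6\<close> enters: \<open>s + 1\<close> sizes already need
    \<open>triangular s + s + 1\<close>, more than the total.\<close>
  have "r \<le> s"
  proof (rule ccontr)
    assume "\<not> r \<le> s"
    then have "triangular (Suc s) \<le> triangular r" by (intro triangular_mono) simp
    then show False using total assms(1) by (simp add: triangular_Suc)
  qed
  have deg: "deg (triangular s + 6) p + 2 * r = r * (r + 1) + card G + card (repeated_parts p)"
    using deg_eq[OF assms(2)] cG by (simp add: r_def)
  have "card (gap_parts p) \<le> r" "card (repeated_parts p) \<le> r"
    unfolding r_def by (auto simp: gap_parts_def repeated_parts_def intro!: card_mono)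
  then have "deg (triangular s + 6) p \<le> r * (r + 1)" using deg cG by simp
  have "\<not> r \<le> s - 1"
  proof
    assume "r \<le> s - 1"
    then have "r * (r + 1) \<le> (s - 1) * s" using assms(1) by (intro mult_le_mono) auto
    then show False
      using \<open>deg (triangular s + 6) p \<le> r * (r + 1)\<close> assms(3) by (simp add: mult.commute)
  qed
  then have rs: "r = s" using \<open>r \<le> s\<close> by simp
  have "s * (s - 1) + 2 * s = s * (s + 1)" using assms(1) by (cases s) auto
  then have "4 \<le> card G + card (repeated_parts p)" using deg assms(3) unfolding rs by linarith
  moreover have "triangular (card G) + triangular (card (repeated_parts p)) \<le> 6"
    using total TG TR unfolding rs by linarith
  ultimately have two: "card G = 2" "card (repeated_parts p) = 2"
    using two_two_of_triangular_bound by blast+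
  have "triangular 2 = 3" by (simp add: triangular_def)
  \<comment> \<open>Both minimal costs are 3 and use up the whole surplus 6, so every other
    contribution vanishes.\<close>
  then have eqs: "\<Sum>(w ` G) = 3" "\<Sum>(repeated_parts p) = 3"
    "(\<Sum>h \<in> {1..N} - ?S - G. w h) = 0" "sum_mset (E - mset_set (repeated_parts p)) = 0"
    using total TG TR unfolding two rs by linarith+
  have R: "repeated_parts p = {1, 2}" using nat_set_card_2_sum_3[OF two(2) E0 eqs(2)] .
  have wG: "w ` G = {1, 2}" using nat_set_card_2_sum_3[OF _ gaps(2) eqs(1)] cwG two(1) by simp
  then have "1 \<in> w ` G" "2 \<in> w ` G" by simp_all
  then obtain a b where ab: "a \<in> G" "w a = 1" "b \<in> G" "w b = 2" by (metis imageE)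
  have "G = {a, b}"
    using ab two(1) finG card_subset_eq[of G "{a, b}"] by (cases "a = b") auto
  \<comment> \<open>A hole below \<open>N\<close> outside \<open>G\<close> would have positive cost,
    since \<open>N\<close> lies above it.\<close>
  moreover have "h \<in> G" if "1 \<le> h" "h < N" "h \<notin> ?S" for h
  proof (rule ccontr)
    assume "h \<notin> G"
    then have "w h = 0" using eqs(3) that by auto
    then show False using that N by (auto simp: w_def)
  qed
  ultimately have S: "?S = extremal_sizes s"
    using ab N p(1) rs assms(1)
    by (intro sizes_unique[where a = a and b = b and N = N]) (auto simp: G_def w_def r_def)
  \<comment> \<open>The remaining copies are positive and sum to 0, so no part occurs three
    times.\<close>
  have "0 \<notin># E - mset_set (repeated_parts p)" using setE E0 by (metis in_diffD)
  then have "E - mset_set (repeated_parts p) = {#}" using eqs(4) by (metis multiset_nonemptyE sum_mset_0_iff)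
  moreover have "mset_set (repeated_parts p) \<subseteq># E" by (metis setE mset_set_set_mset_msubset)
  ultimately have "E = mset_set {1, 2}" by (metis R add.right_neutral subset_mset.add_diff_inverse)
  moreover have "p = mset_set ?S + E"
    by (metis E_def mset_set_set_mset_msubset subset_mset.add_diff_inverse)
  ultimately show ?thesis using S two cG by (simp add: extremal_partition_def)
qed

section \<open>Sum, degree and self-conjugacy of the extremal partition\<close>

lemma extremal_sizes_props:
  assumes "6 \<le> s"
  shows "finite (extremal_sizes s)" "0 \<notin> extremal_sizes s" "card (extremal_sizes s) = s"
    "set_mset (extremal_partition s) = extremal_sizes s"
    "\<Sum>(extremal_sizes s) = triangular s + 3"
proof -
  show fin: "finite (extremal_sizes s)" and "0 \<notin> extremal_sizes s"
    using assms by (auto simp: extremal_sizes_def)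
  show "card (extremal_sizes s) = s"
    using assms unfolding extremal_sizes_def by (subst card_Un_disjoint) auto
  show "set_mset (extremal_partition s) = extremal_sizes s"
    using fin assms by (auto simp: extremal_partition_def extremal_sizes_def)
  \<comment> \<open>With \<open>s = k + 2\<close>, the top sizes add to \<open>2 * k + 6\<close>,
    which is 3 more than \<open>(k + 1) + (k + 2)\<close>.\<close>
  obtain k where k: "s = Suc (Suc k)" using assms by (intro that[of "s - 2"]) simp
  have "\<Sum>{1..k} = triangular k"
    by (induction k) (auto simp: triangular_Suc, simp add: triangular_def)
  then show "\<Sum>(extremal_sizes s) = triangular s + 3"
    unfolding extremal_sizes_def k by (subst sum.union_disjoint) (auto simp: triangular_Suc)
qed

lemma extremal_partition_in_partitions:
  assumes "6 \<le> s"
  shows "extremal_partition s \<in> partitions (triangular s + 6)"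
proof -
  note props = extremal_sizes_props[OF assms]
  have "sum_mset (mset_set (extremal_sizes s)) = triangular s + 3"
    using props(5) sum_unfold_sum_mset[of "\<lambda>x. x" "extremal_sizes s"] by simp
  then have "sum_mset (extremal_partition s) = triangular s + 6"
    by (simp add: extremal_partition_def)
  then show ?thesis using props(2,4) by (simp add: partitions_def)
qed

lemma deg_extremal_partition:
  assumes "6 \<le> s"
  shows "deg (triangular s + 6) (extremal_partition s) = s * (s - 1) + 4"
proof -
  let ?p = "extremal_partition s"
  note props = extremal_sizes_props[OF assms]
  have "gap_parts ?p = {s, s + 2}"
    unfolding gap_parts_def props(4) using assms by (auto simp: extremal_sizes_def)
  then have "card (gap_parts ?p) = 2" by simp
  moreover have "repeated_parts ?p = {1, 2}"
    unfolding repeated_parts_def props(4) using assms props(1)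
    by (auto simp: extremal_partition_def extremal_sizes_def count_mset_set' split: if_splits)
  then have "card (repeated_parts ?p) = 2" by simp
  moreover have "s * (s - 1) + 2 * s = s * (s + 1)" using assms by (cases s) auto
  ultimately show ?thesis
    using deg_eq[OF extremal_partition_in_partitions[OF assms]] props(3,4) by simp
qed

text \<open>On the middle rows \<open>3..s - 2\<close> the row length is the reflection
  \<open>s + 1 - j\<close>, which permutes that interval. The six outer rows give
  \<open>s + 2, s, 2, 2, 1, 1\<close>.\<close>

lemma conjugate_extremal_partition:
  assumes "6 \<le> s"
  shows "conjugate (extremal_partition s) = extremal_partition s"
proof -
  let ?p = "extremal_partition s" and ?S = "extremal_sizes s"
  note props = extremal_sizes_props[OF assms]
  have rows: "{j. 1 \<le> j \<and> (\<exists>x \<in># ?p. j \<le> x)} = {1..s + 2}"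
  proof
    show "{j. 1 \<le> j \<and> (\<exists>x \<in># ?p. j \<le> x)} \<subseteq> {1..s + 2}"
    proof
      fix j assume "j \<in> {j. 1 \<le> j \<and> (\<exists>x \<in># ?p. j \<le> x)}"
      then obtain x where "x \<in> ?S" "1 \<le> j" "j \<le> x" using props(4) by auto
      moreover have "x \<le> s + 2" using \<open>x \<in> ?S\<close> by (auto simp: extremal_sizes_def)
      ultimately show "j \<in> {1..s + 2}" by simp
    qed
    have "s + 2 \<in># ?p" unfolding props(4) by (simp add: extremal_sizes_def)
    then show "{1..s + 2} \<subseteq> {j. 1 \<le> j \<and> (\<exists>x \<in># ?p. j \<le> x)}" by auto
  qed
  have "j \<in> {1..s + 2} \<longleftrightarrow> j \<in> {3..s - 2} \<union> {1, 2, s - 1, s, s + 1, s + 2}" for j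
    using assms by simp linarith
  then have "{1..s + 2} = {3..s - 2} \<union> {1, 2, s - 1, s, s + 1, s + 2}" by blast
  moreover have "mset_set ({3..s - 2} \<union> {1, 2, s - 1, s, s + 1, s + 2})
      = mset_set {3..s - 2} + {#1, 2, s - 1, s, s + 1, s + 2#}"
  proof -
    obtain k where "s = Suc k" "5 \<le> k" using assms by (cases s) auto
    then show ?thesis by (subst mset_set_Union) auto
  qed
  ultimately have rows_mset: "mset_set {1..s + 2} = mset_set {3..s - 2} + {#1, 2, s - 1, s, s + 1, s + 2#}"
    by simp
  have conj: "conjugate ?p = image_mset (\<lambda>j. parts_ge j ?p) (mset_set {3..s - 2})
      + {#parts_ge 1 ?p, parts_ge 2 ?p, parts_ge (s - 1) ?p, parts_ge s ?p, parts_ge (s + 1) ?p, parts_ge (s + 2) ?p#}"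
    unfolding conjugate_def rows rows_mset by simp
  \<comment> \<open>The two correction terms count the extra copies of 1 and 2.\<close>
  have pg: "parts_ge j ?p = card {x \<in> ?S. j \<le> x} + of_bool (j \<le> 1) + of_bool (j \<le> 2)" for j
    using props(1) by (simp add: extremal_partition_def)
  have mid: "parts_ge j ?p = s + 1 - j" if "j \<in> {3..s - 2}" for j
  proof -
    have "{x \<in> ?S. j \<le> x} = {j..s - 2} \<union> {s, s + 2}"
      using that assms by (auto simp: extremal_sizes_def)
    also have "card \<dots> = s + 1 - j" using that assms by (subst card_Un_disjoint) auto
    finally show ?thesis using that by (simp add: pg)
  qed
  have "1 \<le> x \<and> (2 \<le> x \<longleftrightarrow> x \<noteq> 1)" if "x \<in> ?S" for x
    using props(2) that by (cases "x = 0") auto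
  then have "{x \<in> ?S. 1 \<le> x} = ?S" "{x \<in> ?S. 2 \<le> x} = ?S - {1}" by blast+
  moreover have "1 \<in> ?S" using assms by (simp add: extremal_sizes_def)
  ultimately have "card {x \<in> ?S. 1 \<le> x} = s" "card {x \<in> ?S. 2 \<le> x} = s - 1"
    using props(1,3) by simp_all
  then have low: "parts_ge 1 ?p = s + 2" "parts_ge 2 ?p = s"
    using assms by (simp_all add: pg)
  have "{x \<in> ?S. s - 1 \<le> x} = {s, s + 2}" "{x \<in> ?S. s \<le> x} = {s, s + 2}"
    "{x \<in> ?S. s + 1 \<le> x} = {s + 2}" "{x \<in> ?S. s + 2 \<le> x} = {s + 2}"
    using assms by (auto simp: extremal_sizes_def)
  then have high: "parts_ge (s - 1) ?p = 2" "parts_ge s ?p = 2" "parts_ge (s + 1) ?p = 1" "parts_ge (s + 2) ?p = 1"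
    unfolding pg using assms by auto
  have "image_mset (\<lambda>j. parts_ge j ?p) (mset_set {3..s - 2}) = image_mset (\<lambda>j. s + 1 - j) (mset_set {3..s - 2})"
    by (rule image_mset_cong) (use mid in auto)
  also have "\<dots> = mset_set ((\<lambda>j. s + 1 - j) ` {3..s - 2})"
    by (rule image_mset_mset_set) (auto simp: inj_on_def)
  also have "(\<lambda>j. s + 1 - j) ` {3..s - 2} = {3..s - 2}"
  proof
    show "{3..s - 2} \<subseteq> (\<lambda>j. s + 1 - j) ` {3..s - 2}"
    proof
      fix x assume "x \<in> {3..s - 2}"
      then show "x \<in> (\<lambda>j. s + 1 - j) ` {3..s - 2}" by (intro image_eqI[of _ _ "s + 1 - x"]) auto
    qed
  qed auto
  finally have "conjugate ?p = mset_set {3..s - 2} + {#s + 2, s, 2, 2, 1, 1#}"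
    unfolding conj low high by simp
  moreover have "j \<in> ?S \<longleftrightarrow> j \<in> {3..s - 2} \<union> {1, 2, s, s + 2}" for j
    unfolding extremal_sizes_def using assms by simp linarith
  then have "?S = {3..s - 2} \<union> {1, 2, s, s + 2}" by blast
  moreover have "mset_set ({3..s - 2} \<union> {1, 2, s, s + 2}) = mset_set {3..s - 2} + {#1, 2, s, s + 2#}"
    using assms by (subst mset_set_Union) auto
  ultimately show ?thesis by (simp add: extremal_partition_def)
qed

theorem proposition7p4:
  fixes s :: nat
  assumes "s \<ge> 6"
  shows "AB_pairs (triangular s + 6) = {(2, 2)}
    \<and> card (max_deg_partitions_AB (triangular s + 6) (2, 2)) = 1
    \<and> card (max_deg_partitions (triangular s + 6)) = 1
    \<and> num_self_conjugate (triangular s + 6) = 1"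
proof -
  let ?n = "triangular s + 6" and ?p = "extremal_partition s"
  note mem = extremal_partition_in_partitions[OF assms] and deg = deg_extremal_partition[OF assms]
  have two: "card (gap_parts ?p) = 2" "card (repeated_parts ?p) = 2"
    using large_deg_imp_extremal[OF assms mem] deg by auto
  then have AB: "num_A ?p = 2" "num_B ?p = 2"
    using mem by (auto simp: num_A_eq num_B_eq partitions_def)
  have unique: "q = ?p" if "q \<in> partitions ?n" "deg ?n ?p \<le> deg ?n q" for q
    using large_deg_imp_extremal[OF assms that(1)] that(2) deg by auto
  \<comment> \<open>A partition of at least this degree is \<open>?p\<close> itself, so uniqueness
    implies maximality.\<close>
  have "deg ?n q \<le> deg ?n ?p" if "q \<in> partitions ?n" for q
    using unique[OF that] by (cases "deg ?n ?p \<le> deg ?n q") auto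
  then have "max_deg ?n = deg ?n ?p"
    unfolding max_deg_def using mem by (intro Max_eqI) (auto simp: finite_partitions)
  then have M: "max_deg_partitions ?n = {?p}"
    unfolding max_deg_partitions_def using mem unique by auto
  have "max_deg_partitions_AB ?n (2, 2) = {?p}"
    unfolding max_deg_partitions_AB_def M using AB by auto
  moreover have "{p \<in> max_deg_partitions ?n. p = conjugate p} = {?p}"
    unfolding M using conjugate_extremal_partition[OF assms] by auto
  ultimately show ?thesis
    unfolding AB_pairs_def num_self_conjugate_def M by (simp add: AB)
qed

end
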